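(* Let $n\in\mathbb{Z}_+$. (i) For all real $q,r>0$, the polynomial $y(x)=\mathcal{L}_n(x;q,r)$ satisfies the differential equation $$x^2y'''+(q+r+1-x)\,x\,y''+(qr-2x)\,y'+n\{xy'+y\}=0.$$ (ii) For all real $a,b,c>0$, the polynomial $y(x)=\mathcal{P}_n(x;a,b,c)$ satisfies the differential equation $$(1-x)x^2y'''+\bigl(a+c+1-(a+b+3)x\bigr)x\,y''+\bigl(ac-2(a+b)x\bigr)y'+n(n+a+b-1)\{xy'+y\}=0.$$
   Context: $\mathbb{Z}_+$ is the set of non-negative integers. The shifted factorial is $(u)_0=1$, $(u)_k=u(u+1)\cdots(u+k-1)$ for $k\geq 1$. For $q,r>0$, $a,b,c>0$ and $n\in\mathbb{Z}_+$, $$\mathcal{L}_n(x;q,r)={}_2F_2(-n,1;q,r;x)=\sum_{k=0}^{n}\frac{(-n)_k(1)_k}{(q)_k(r)_k}\frac{x^k}{k!},$$ $$\mathcal{P}_n(x;a,b,c)={}_3F_2(-n,n-1+a+b,1;a,c;x)=\sum_{k=0}^{n}\frac{(-n)_k(n-1+a+b)_k(1)_k}{(a)_k(c)_k}\frac{x^k}{k!}.$$ *)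

theory Defs
  imports Complex_Main "HOL-Computational_Algebra.Polynomial"
begin

text \<open>
  The shifted factorial \<open>(u)\<^sub>k\<close> is \<open>pochhammer u k\<close>. Since \<open>(-n)\<^sub>k\<close> vanishes for \<open>k > n\<close>,
  the hypergeometric series \<open>\<^sub>2F\<^sub>2(-n, 1; q, r; x)\<close> and \<open>\<^sub>3F\<^sub>2(-n, n-1+a+b, 1; a, c; x)\<close>
  terminate at \<open>k = n\<close>, so they are polynomials in \<open>x\<close>.
\<close>

definition calL :: "nat \<Rightarrow> real \<Rightarrow> real \<Rightarrow> real poly" where
  "calL n q r =
     (\<Sum>k=0..n. monom (pochhammer (- real n) k * pochhammer 1 k
                        / (pochhammer q k * pochhammer r k) / fact k) k)"

definition calP :: "nat \<Rightarrow> real \<Rightarrow> real \<Rightarrow> real \<Rightarrow> real poly" where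
  "calP n a b c =
     (\<Sum>k=0..n. monom (pochhammer (- real n) k * pochhammer (real n - 1 + a + b) k * pochhammer 1 k
                        / (pochhammer a k * pochhammer c k) / fact k) k)"

lemma poly_calL:
  "poly (calL n q r) x =
     (\<Sum>k=0..n. pochhammer (- real n) k * pochhammer 1 k
                 / (pochhammer q k * pochhammer r k) * (x ^ k / fact k))"
  by (simp add: calL_def poly_sum poly_monom)

lemma poly_calP:
  "poly (calP n a b c) x =
     (\<Sum>k=0..n. pochhammer (- real n) k * pochhammer (real n - 1 + a + b) k * pochhammer 1 k
                 / (pochhammer a k * pochhammer c k) * (x ^ k / fact k))"
  by (simp add: calP_def poly_sum poly_monom)

end

theory Submission imports Defs begin

text \<open>
  Both equations are the same fact. The factor \<open>(1)\<^sub>k\<close> cancels \<open>k!\<close>, so the coefficients of each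
  polynomial \<open>y\<close> satisfy a two-term recurrence
  \<open>(k + a) (k + c) y\<^sub>k\<^sub>+\<^sub>1 = (e k\<^sup>2 + f k - L) y\<^sub>k\<close>, with \<open>e = 0\<close>, \<open>f = 1\<close>, \<open>L = n\<close> for
  \<open>calL\<close> (where \<open>a, c\<close> are \<open>q, r\<close>) and \<open>e = 1\<close>, \<open>f = a + b - 1\<close>, \<open>L = n (n + a + b - 1)\<close> for
  \<open>calP\<close>. In terms of the Euler operator \<open>\<theta> = x d/dx\<close>, which multiplies \<open>x\<^sup>k\<close> by \<open>k\<close>, the recurrence
  says that \<open>(\<theta> + a - 1) (\<theta> + c - 1) y - x (e \<theta>\<^sup>2 + f \<theta> - L) y\<close> is the constant
  \<open>(a - 1) (c - 1) y\<^sub>0\<close>: only the coefficient of \<open>x\<^sup>0\<close> is not governed by it. One differentiation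
  removes the constant, and this is why the equation has order three although the recurrence is
  quadratic in \<open>k\<close>. Expanding the derivative in powers of \<open>d/dx\<close> gives
  \<open>third_order_ode_of_recurrence\<close>, of which the two equations are specialisations.
\<close>

lemma coeff_x_pderiv:
  fixes p :: "real poly"
  shows "coeff (pCons 0 (pderiv p)) k = real k * coeff p k"
  by (cases k) (simp_all add: coeff_pderiv)

lemma coeff_x2_pderiv2:
  fixes p :: "real poly"
  shows "coeff (pCons 0 (pCons 0 (pderiv (pderiv p)))) k = real k * (real k - 1) * coeff p k"
  by (cases k) (simp_all add: coeff_x_pderiv coeff_pderiv)

lemma coeff_x3_pderiv3:
  fixes p :: "real poly"
  shows "coeff (pCons 0 (pCons 0 (pCons 0 (pderiv (pderiv (pderiv p)))))) k
    = real k * (real k - 1) * (real k - 2) * coeff p k"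
  by (cases k) (simp_all add: coeff_x2_pderiv2 coeff_pderiv)

text \<open>
  The coefficient of \<open>x\<^sup>k\<close> on the left is \<open>k + 1\<close> times the difference of the two sides of the
  recurrence. The numbers \<open>4 e + f\<close> and \<open>2 (e + f)\<close> come from writing \<open>(k + 1) (e k\<^sup>2 + f k)\<close> in
  falling factorials, as \<open>e k (k - 1) (k - 2) + (4 e + f) k (k - 1) + 2 (e + f) k\<close>.
\<close>

lemma third_order_ode_of_recurrence:
  fixes y :: "real poly" and a c e f L x :: real
  assumes rec: "\<And>k. (real k + a) * (real k + c) * coeff y (Suc k)
                      = (e * (real k)\<^sup>2 + f * real k - L) * coeff y k"
  shows "(1 - e * x) * x\<^sup>2 * poly (pderiv (pderiv (pderiv y))) x
      + (a + c + 1 - (4 * e + f) * x) * x * poly (pderiv (pderiv y)) x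
      + (a * c - 2 * (e + f) * x) * poly (pderiv y) x
      + L * (x * poly (pderiv y) x + poly y x) = 0"
proof -
  let ?y1 = "pderiv y" and ?y2 = "pderiv (pderiv y)" and ?y3 = "pderiv (pderiv (pderiv y))"
  define P where "P = pCons 0 (pCons 0 ?y3) - smult e (pCons 0 (pCons 0 (pCons 0 ?y3)))
    + smult (a + c + 1) (pCons 0 ?y2) - smult (4 * e + f) (pCons 0 (pCons 0 ?y2))
    + smult (a * c) ?y1 - smult (2 * (e + f)) (pCons 0 ?y1)
    + smult L (pCons 0 ?y1 + y)"
  have "P = 0"
  proof (rule poly_eqI)
    fix k
    have "coeff P k = (real k + 1) * ((real k + a) * (real k + c) * coeff y (Suc k)
        - (e * (real k)\<^sup>2 + f * real k - L) * coeff y k)"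
      unfolding P_def coeff_add coeff_diff coeff_smult
        coeff_x3_pderiv3 coeff_x2_pderiv2 coeff_x_pderiv coeff_pderiv
      by (simp add: algebra_simps power2_eq_square)
    then show "coeff P k = coeff 0 k"
      by (simp add: rec)
  qed
  then have "poly P x = 0"
    by simp
  then show ?thesis
    unfolding P_def by (simp add: algebra_simps power2_eq_square)
qed

text \<open>
  The closed form holds for every \<open>k\<close>, also beyond the degree, because \<open>(-n)\<^sub>k\<close> vanishes for
  \<open>k > n\<close>; the recurrence thus needs no separate treatment at \<open>k = n\<close>.
\<close>

lemma coeff_calL:
  "coeff (calL n q r) k = pochhammer (- real n) k / (pochhammer q k * pochhammer r k)"
proof -
  have "pochhammer (- real n) k = 0" if "k > n"
    using that by (simp add: pochhammer_of_nat_eq_0_iff)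
  then show ?thesis
    by (auto simp: calL_def coeff_sum coeff_monom pochhammer_fact[symmetric])
qed

lemma coeff_calP:
  "coeff (calP n a b c) k
    = pochhammer (- real n) k * pochhammer (real n - 1 + a + b) k / (pochhammer a k * pochhammer c k)"
proof -
  have "pochhammer (- real n) k = 0" if "k > n"
    using that by (simp add: pochhammer_of_nat_eq_0_iff)
  then show ?thesis
    by (auto simp: calP_def coeff_sum coeff_monom pochhammer_fact[symmetric])
qed

lemma calL_recurrence:
  assumes "q > 0" "r > 0"
  shows "(real k + q) * (real k + r) * coeff (calL n q r) (Suc k)
    = (real k - real n) * coeff (calL n q r) k"
proof -
  have "pochhammer q k > 0" "pochhammer r k > 0" "q + real k > 0" "r + real k > 0"
    using assms by (simp_all add: pochhammer_pos)
  then show ?thesis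
    by (simp add: coeff_calL pochhammer_Suc divide_simps) (simp add: algebra_simps)
qed

lemma calP_recurrence:
  assumes "a > 0" "c > 0"
  shows "(real k + a) * (real k + c) * coeff (calP n a b c) (Suc k)
    = (real k - real n) * (real k + real n - 1 + a + b) * coeff (calP n a b c) k"
proof -
  have "pochhammer a k > 0" "pochhammer c k > 0" "a + real k > 0" "c + real k > 0"
    using assms by (simp_all add: pochhammer_pos)
  then show ?thesis
    by (simp add: coeff_calP pochhammer_Suc divide_simps) (simp add: algebra_simps)
qed

theorem theorem3:
  fixes n :: nat
  shows "(\<forall>q r :: real. q > 0 \<longrightarrow> r > 0 \<longrightarrow>
           (let y = calL n q r; y' = pderiv y; y'' = pderiv y'; y''' = pderiv y'' in
            \<forall>x :: real.
              x\<^sup>2 * poly y''' x + (q + r + 1 - x) * x * poly y'' x + (q * r - 2 * x) * poly y' x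
                + real n * (x * poly y' x + poly y x) = 0))
       \<and> (\<forall>a b c :: real. a > 0 \<longrightarrow> b > 0 \<longrightarrow> c > 0 \<longrightarrow>
           (let y = calP n a b c; y' = pderiv y; y'' = pderiv y'; y''' = pderiv y'' in
            \<forall>x :: real.
              (1 - x) * x\<^sup>2 * poly y''' x + (a + c + 1 - (a + b + 3) * x) * x * poly y'' x
                + (a * c - 2 * (a + b) * x) * poly y' x
                + real n * (real n + a + b - 1) * (x * poly y' x + poly y x) = 0))"
proof (intro conjI allI impI)
  fix q r :: real
  assume "q > 0" "r > 0"
  then have rec: "(real k + q) * (real k + r) * coeff (calL n q r) (Suc k)
      = (0 * (real k)\<^sup>2 + 1 * real k - real n) * coeff (calL n q r) k" for k
    by (simp add: calL_recurrence)
  show "let y = calL n q r; y' = pderiv y; y'' = pderiv y'; y''' = pderiv y'' in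
      \<forall>x :: real.
        x\<^sup>2 * poly y''' x + (q + r + 1 - x) * x * poly y'' x + (q * r - 2 * x) * poly y' x
          + real n * (x * poly y' x + poly y x) = 0"
    using third_order_ode_of_recurrence[OF rec] by (simp add: Let_def)
next
  fix a b c :: real
  assume "a > 0" "b > 0" "c > 0"
  (* e k^2 + f k - L has the roots k = n and k = 1 - n - a - b *)
  have rec: "(real k + a) * (real k + c) * coeff (calP n a b c) (Suc k)
      = (1 * (real k)\<^sup>2 + (a + b - 1) * real k - real n * (real n + a + b - 1))
        * coeff (calP n a b c) k" for k
    unfolding calP_recurrence[OF \<open>a > 0\<close> \<open>c > 0\<close>] by (simp add: algebra_simps power2_eq_square)
  have coeffs: "4 * 1 + (a + b - 1) = a + b + 3" "1 + (a + b - 1) = a + b"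
    by simp_all
  show "let y = calP n a b c; y' = pderiv y; y'' = pderiv y'; y''' = pderiv y'' in
      \<forall>x :: real.
        (1 - x) * x\<^sup>2 * poly y''' x + (a + c + 1 - (a + b + 3) * x) * x * poly y'' x
          + (a * c - 2 * (a + b) * x) * poly y' x
          + real n * (real n + a + b - 1) * (x * poly y' x + poly y x) = 0"
    using third_order_ode_of_recurrence[OF rec, unfolded coeffs] by (simp add: Let_def)
qed

end
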